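(* For any $M>-\frac14$ and $w>0$, the curve $u\mapsto(\rho_1(u),\rho_2(u))$ defined on $[0,2\pi]$ by $$\rho_1(u)=A\cos u,\qquad \rho_2(u)=\frac{-1+\sqrt{1+4M+B\cos^2u}\,\sin u}{2\sqrt{1+w^2A^2\cos^2u}},$$ where $$A=\frac{\sqrt{-1+Mw^2+\sqrt{1+(1+2M)w^2+M^2w^4}}}{\sqrt2\,w},$$ $$B=\frac{2+2M^2w^4+w^2+2(Mw^2-1)\sqrt{1+(1+2M)w^2+M^2w^4}}{w^2},$$ is a closed simple regular curve that parametrizes the heart-shaped curve $h_w^{-1}(M)$, where $h_w(x,y)=x^2+y^2+\frac{y}{\sqrt{1+w^2x^2}}$.
   Context: The level sets $h_w^{-1}(M)=\{(x,y)\in\mathbb{R}^2: h_w(x,y)=M\}$, $M>-\frac14$, are called heart-shaped curves. "Closed simple" means the curve takes the same value at $0$ and $2\pi$ and is injective on $[0,2\pi)$. *)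

theory Defs
  imports "HOL-Analysis.Analysis"
begin

definition heart_fun :: "real \<Rightarrow> real \<times> real \<Rightarrow> real" where
  "heart_fun w = (\<lambda>(x, y). x\<^sup>2 + y\<^sup>2 + y / sqrt (1 + w\<^sup>2 * x\<^sup>2))"

definition heart_curve :: "real \<Rightarrow> real \<Rightarrow> (real \<times> real) set" where
  "heart_curve w M = heart_fun w -` {M}"

definition heart_A :: "real \<Rightarrow> real \<Rightarrow> real" where
  "heart_A w M =
     sqrt (- 1 + M * w\<^sup>2 + sqrt (1 + (1 + 2 * M) * w\<^sup>2 + M\<^sup>2 * w ^ 4)) / (sqrt 2 * w)"

definition heart_B :: "real \<Rightarrow> real \<Rightarrow> real" where
  "heart_B w M =
     (2 + 2 * M\<^sup>2 * w ^ 4 + w\<^sup>2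
       + 2 * (M * w\<^sup>2 - 1) * sqrt (1 + (1 + 2 * M) * w\<^sup>2 + M\<^sup>2 * w ^ 4)) / w\<^sup>2"

definition rho1 :: "real \<Rightarrow> real \<Rightarrow> real \<Rightarrow> real" where
  "rho1 w M u = heart_A w M * cos u"

definition rho2 :: "real \<Rightarrow> real \<Rightarrow> real \<Rightarrow> real" where
  "rho2 w M u =
     (- 1 + sqrt (1 + 4 * M + heart_B w M * (cos u)\<^sup>2) * sin u)
       / (2 * sqrt (1 + w\<^sup>2 * (heart_A w M)\<^sup>2 * (cos u)\<^sup>2))"

definition closed_simple_curve :: "(real \<Rightarrow> 'a) \<Rightarrow> real \<Rightarrow> real \<Rightarrow> bool" where
  "closed_simple_curve \<gamma> a b \<longleftrightarrow> \<gamma> a = \<gamma> b \<and> inj_on \<gamma> {a..<b}"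

text \<open>Infinite differentiability on a closed interval: \<open>D n\<close> is the \<open>n\<close>-th derivative,
  one-sided at the end points.\<close>

definition smooth_curve :: "(real \<Rightarrow> 'a::real_normed_vector) \<Rightarrow> real \<Rightarrow> real \<Rightarrow> bool" where
  "smooth_curve \<gamma> a b \<longleftrightarrow>
     (\<exists>D :: nat \<Rightarrow> real \<Rightarrow> 'a. D 0 = \<gamma> \<and>
        (\<forall>n. \<forall>t\<in>{a..b}. (D n has_vector_derivative D (Suc n) t) (at t within {a..b})))"

definition regular_curve :: "(real \<Rightarrow> 'a::real_normed_vector) \<Rightarrow> real \<Rightarrow> real \<Rightarrow> bool" where
  "regular_curve \<gamma> a b \<longleftrightarrow> smooth_curve \<gamma> a b \<and>
     (\<forall>t\<in>{a..b}. vector_derivative \<gamma> (at t within {a..b}) \<noteq> 0)"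

end

theory Submission
  imports Defs "HOL-Complex_Analysis.Complex_Analysis"
begin

text \<open>
  On the level set, completing the square in \<open>y\<close> turns \<open>heart_fun w (x, y) = M\<close> into
  \<open>(2 q y + 1)\<^sup>2 = 1 + 4 q\<^sup>2 (M - x\<^sup>2)\<close> with \<open>q = sqrt (1 + w\<^sup>2 x\<^sup>2)\<close>. The right-hand side
  is a quadratic polynomial in \<open>x\<^sup>2\<close> with exactly one positive root, and that root is \<open>A\<^sup>2\<close>;
  the constant \<open>B\<close> equals \<open>4 w\<^sup>2 A\<^sup>4\<close>. In terms of \<open>c = x / A\<close> the quadratic therefore
  factors as \<open>(1 - c\<^sup>2) (1 + 4 M + B c\<^sup>2)\<close>
  (\<open>heart_curve_iff\<close>). The second factor is positive, so with \<open>r = sqrt (1 + 4 M + B c\<^sup>2)\<close>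
  and \<open>s = (2 q y + 1) / r\<close> the level set becomes the unit circle \<open>c\<^sup>2 + s\<^sup>2 = 1\<close>,
  and \<open>(rho1, rho2)\<close> is the standard parametrization \<open>c = cos u\<close>, \<open>s = sin u\<close> written in the
  coordinates \<open>(x, y)\<close>. Image and injectivity are inherited from the circle.

  Smoothness holds because both radicands stay positive on the real line, so that both
  coordinates are restrictions of holomorphic functions. As for regularity, \<open>rho1\<close> is
  stationary only where \<open>sin u = 0\<close>; there the radicals, being functions of \<open>cos u\<close>, are
  stationary as well, and the derivative of \<open>rho2\<close> reduces to \<open>r cos u / (2 q)\<close>, which is not 0.
\<close>

section \<open>The constants and the equation of the level set\<close>

text \<open>The quadratic formula, solved for \<open>A\<^sup>2\<close>: the hypothesis on \<open>M\<close> makes the constant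
  coefficient nonzero, of sign opposite to the leading one, so the larger root is positive.\<close>

lemma heart_A_pos_and_root:
  fixes M w :: real
  assumes M: "M > - 1 / 4" and w: "w > 0"
  shows "heart_A w M > 0"
    and "4 * w\<^sup>2 * (heart_A w M) ^ 4 = 1 + 4 * M + 4 * (M * w\<^sup>2 - 1) * (heart_A w M)\<^sup>2"
    and "heart_B w M = 4 * w\<^sup>2 * (heart_A w M) ^ 4"
proof -
  define P where "P = 1 + (1 + 2 * M) * w\<^sup>2 + M\<^sup>2 * w ^ 4"
  define S where "S = sqrt P"
  define T where "T = - 1 + M * w\<^sup>2 + S"
  \<comment> \<open>Up to a factor 16, \<open>P\<close> is the discriminant of the quadratic in \<open>x\<^sup>2\<close>.\<close>
  have P: "P = (1 - M * w\<^sup>2)\<^sup>2 + (1 + 4 * M) * w\<^sup>2"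
    unfolding P_def by (simp add: power2_eq_square power4_eq_xxxx algebra_simps)
  have "(1 + 4 * M) * w\<^sup>2 > 0" using M w by simp
  then have P_gt: "P > (1 - M * w\<^sup>2)\<^sup>2" unfolding P by simp
  then have "P > 0" using zero_le_power2[of "1 - M * w\<^sup>2"] by linarith
  then have S2: "S\<^sup>2 = P" unfolding S_def by simp
  have "S > 1 - M * w\<^sup>2" unfolding S_def using P_gt by (rule real_less_rsqrt)
  then have T: "T > 0" unfolding T_def by simp
  have A: "heart_A w M = sqrt T / (sqrt 2 * w)"
    unfolding heart_A_def T_def S_def P_def ..
  then show "heart_A w M > 0" using T w by simp
  have A2: "(heart_A w M)\<^sup>2 = T / (2 * w\<^sup>2)"
    unfolding A using T by (simp add: power_divide power_mult_distrib)
  have A4: "4 * w\<^sup>2 * (heart_A w M) ^ 4 = T\<^sup>2 / w\<^sup>2"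
  proof -
    have "(heart_A w M) ^ 4 = (T / (2 * w\<^sup>2))\<^sup>2"
      unfolding A2[symmetric] by simp
    then show ?thesis using w by (simp add: power2_eq_square)
  qed
  have "T\<^sup>2 = S\<^sup>2 - (1 - M * w\<^sup>2)\<^sup>2 + 2 * (M * w\<^sup>2 - 1) * T"
    unfolding T_def by (simp add: power2_eq_square algebra_simps)
  then have "T\<^sup>2 = (1 + 4 * M) * w\<^sup>2 + 2 * (M * w\<^sup>2 - 1) * T"
    unfolding S2 P by simp
  then show "4 * w\<^sup>2 * (heart_A w M) ^ 4 = 1 + 4 * M + 4 * (M * w\<^sup>2 - 1) * (heart_A w M)\<^sup>2"
    unfolding A4 A2 using w by (simp add: field_simps)
  have "T\<^sup>2 = S\<^sup>2 + (1 - M * w\<^sup>2)\<^sup>2 + 2 * (M * w\<^sup>2 - 1) * S"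
    unfolding T_def by (simp add: power2_eq_square algebra_simps)
  then have "2 + 2 * M\<^sup>2 * w ^ 4 + w\<^sup>2 + 2 * (M * w\<^sup>2 - 1) * S = T\<^sup>2"
    unfolding S2 P_def by (simp add: power2_eq_square power4_eq_xxxx algebra_simps)
  then show "heart_B w M = 4 * w\<^sup>2 * (heart_A w M) ^ 4"
    unfolding A4 heart_B_def S_def P_def by simp
qed

text \<open>Completing the square in \<open>y\<close>, followed by the factorization at the root \<open>A\<^sup>2\<close>.\<close>

lemma heart_curve_iff:
  fixes M w c y :: real
  assumes M: "M > - 1 / 4" and w: "w > 0"
  shows "(heart_A w M * c, y) \<in> heart_curve w M \<longleftrightarrow>
    (2 * sqrt (1 + w\<^sup>2 * (heart_A w M)\<^sup>2 * c\<^sup>2) * y + 1)\<^sup>2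
      = (1 - c\<^sup>2) * (1 + 4 * M + heart_B w M * c\<^sup>2)"
proof -
  define A where "A = heart_A w M"
  define q where "q = sqrt (1 + w\<^sup>2 * A\<^sup>2 * c\<^sup>2)"
  have root: "4 * w\<^sup>2 * A ^ 4 = 1 + 4 * M + 4 * (M * w\<^sup>2 - 1) * A\<^sup>2"
    and B: "heart_B w M = 4 * w\<^sup>2 * A ^ 4"
    using heart_A_pos_and_root[OF M w] unfolding A_def by auto
  have "1 + w\<^sup>2 * A\<^sup>2 * c\<^sup>2 > 0" by (simp add: add_pos_nonneg)
  then have q: "q > 0" and q2: "q\<^sup>2 = 1 + w\<^sup>2 * A\<^sup>2 * c\<^sup>2" unfolding q_def by simp_all
  have factor: "1 + 4 * q\<^sup>2 * (M - A\<^sup>2 * c\<^sup>2) = (1 - c\<^sup>2) * (1 + 4 * M + heart_B w M * c\<^sup>2)"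
  proof -
    have "(1 - c\<^sup>2) * (1 + 4 * M + heart_B w M * c\<^sup>2)
        = 1 + 4 * M + (heart_B w M - (1 + 4 * M)) * c\<^sup>2 - heart_B w M * c ^ 4"
      by (simp add: power2_eq_square power4_eq_xxxx algebra_simps)
    also have "heart_B w M - (1 + 4 * M) = 4 * (M * w\<^sup>2 - 1) * A\<^sup>2"
      unfolding B root by simp
    finally show ?thesis
      unfolding B q2 by (simp add: power2_eq_square power4_eq_xxxx algebra_simps)
  qed
  have "(A * c, y) \<in> heart_curve w M \<longleftrightarrow> A\<^sup>2 * c\<^sup>2 + y\<^sup>2 + y / q = M"
    unfolding heart_curve_def heart_fun_def q_def
    by (simp add: power_mult_distrib mult.assoc)
  also have "\<dots> \<longleftrightarrow> 4 * q\<^sup>2 * (A\<^sup>2 * c\<^sup>2 + y\<^sup>2 + y / q) = 4 * q\<^sup>2 * M"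
    using q by simp
  also have "4 * q\<^sup>2 * (A\<^sup>2 * c\<^sup>2 + y\<^sup>2 + y / q) = (2 * q * y + 1)\<^sup>2 - 1 + 4 * q\<^sup>2 * (A\<^sup>2 * c\<^sup>2)"
    using q by (simp add: field_simps power2_eq_square)
  also have "\<dots> = 4 * q\<^sup>2 * M \<longleftrightarrow> (2 * q * y + 1)\<^sup>2 = 1 + 4 * q\<^sup>2 * (M - A\<^sup>2 * c\<^sup>2)"
    by (auto simp: algebra_simps)
  finally show ?thesis unfolding factor unfolding A_def q_def .
qed

lemma heart_radicands_pos:
  fixes M w c :: real
  assumes M: "M > - 1 / 4" and w: "w > 0"
  shows "1 + 4 * M + heart_B w M * c\<^sup>2 > 0" "1 + w\<^sup>2 * (heart_A w M)\<^sup>2 * c\<^sup>2 > 0"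
  using M by (simp_all add: heart_A_pos_and_root(3)[OF M w] add_pos_nonneg)

text \<open>This is the change of coordinates to the circle: the defining quotient of \<open>rho2\<close>, solved for
  the second circle coordinate \<open>sin u = (2 q y + 1) / r\<close>.\<close>

lemma rho2_eq_iff:
  fixes M w u y :: real
  assumes M: "M > - 1 / 4" and w: "w > 0"
  shows "rho2 w M u = y \<longleftrightarrow>
    sqrt (1 + 4 * M + heart_B w M * (cos u)\<^sup>2) * sin u
      = 2 * sqrt (1 + w\<^sup>2 * (heart_A w M)\<^sup>2 * (cos u)\<^sup>2) * y + 1"
proof -
  have "sqrt (1 + w\<^sup>2 * (heart_A w M)\<^sup>2 * (cos u)\<^sup>2) > 0"
    using heart_radicands_pos(2)[OF M w] by simp
  then show ?thesis unfolding rho2_def by (auto simp: field_simps)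
qed

section \<open>Image and injectivity\<close>

lemma heart_curve_param_mem:
  fixes M w u :: real
  assumes M: "M > - 1 / 4" and w: "w > 0"
  shows "(rho1 w M u, rho2 w M u) \<in> heart_curve w M"
proof -
  have "(sqrt (1 + 4 * M + heart_B w M * (cos u)\<^sup>2) * sin u)\<^sup>2
      = (1 - (cos u)\<^sup>2) * (1 + 4 * M + heart_B w M * (cos u)\<^sup>2)"
    using heart_radicands_pos(1)[OF M w, of "cos u"]
    by (simp add: power_mult_distrib sin_squared_eq mult.commute)
  then show ?thesis
    unfolding rho1_def heart_curve_iff[OF M w]
    using rho2_eq_iff[OF M w, of u "rho2 w M u"] by simp
qed

lemma heart_curve_param_surj:
  fixes M w :: real
  assumes M: "M > - 1 / 4" and w: "w > 0" and p: "(x, y) \<in> heart_curve w M"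
  obtains u where "0 \<le> u" "u \<le> 2 * pi" "rho1 w M u = x" "rho2 w M u = y"
proof -
  define c where "c = x / heart_A w M"
  have x: "x = heart_A w M * c"
    unfolding c_def using heart_A_pos_and_root(1)[OF M w] by simp
  define r where "r = sqrt (1 + 4 * M + heart_B w M * c\<^sup>2)"
  define s where "s = (2 * sqrt (1 + w\<^sup>2 * (heart_A w M)\<^sup>2 * c\<^sup>2) * y + 1) / r"
  have r: "r > 0" and r2: "r\<^sup>2 = 1 + 4 * M + heart_B w M * c\<^sup>2"
    unfolding r_def using heart_radicands_pos(1)[OF M w, of c] by auto
  have rs: "r * s = 2 * sqrt (1 + w\<^sup>2 * (heart_A w M)\<^sup>2 * c\<^sup>2) * y + 1"
    unfolding s_def using r by simp
  have "(r * s)\<^sup>2 = (1 - c\<^sup>2) * r\<^sup>2"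
    using p unfolding x heart_curve_iff[OF M w] rs r2 .
  then have "s\<^sup>2 = 1 - c\<^sup>2" using r by (simp add: power_mult_distrib)
  then have "c\<^sup>2 + s\<^sup>2 = 1" by simp
  then obtain u where u: "0 \<le> u" "u < 2 * pi" "c = cos u" "s = sin u"
    using sincos_total_2pi by metis
  have "rho1 w M u = x" unfolding rho1_def x u(3) ..
  moreover have "rho2 w M u = y"
    unfolding rho2_eq_iff[OF M w] using rs unfolding r_def u(3,4) .
  ultimately show ?thesis using that u by simp
qed

lemma heart_curve_param_inj:
  fixes M w :: real
  assumes M: "M > - 1 / 4" and w: "w > 0"
  shows "inj_on (\<lambda>u. (rho1 w M u, rho2 w M u)) {0..<2 * pi}"
proof (rule inj_onI)
  fix u v
  assume uv: "u \<in> {0..<2 * pi}" "v \<in> {0..<2 * pi}"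
    and eq: "(rho1 w M u, rho2 w M u) = (rho1 w M v, rho2 w M v)"
  have c: "cos u = cos v"
    using eq heart_A_pos_and_root(1)[OF M w] unfolding rho1_def by simp
  have "sqrt (1 + 4 * M + heart_B w M * (cos u)\<^sup>2) * sin u
      = sqrt (1 + 4 * M + heart_B w M * (cos u)\<^sup>2) * sin v"
    using eq rho2_eq_iff[OF M w, of u "rho2 w M v"] rho2_eq_iff[OF M w, of v "rho2 w M v"] c
    by simp
  then have s: "sin u = sin v"
    using heart_radicands_pos(1)[OF M w, of "cos u"] by simp
  \<comment> \<open>A point of the circle determines its angle up to full turns.\<close>
  obtain n :: int where n: "u = v + 2 * pi * n"
    using sin_cos_eq_iff[of u v] c s by auto
  have "\<bar>2 * pi * real_of_int n\<bar> < 2 * pi"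
    using uv n unfolding atLeastLessThan_iff by linarith
  then have "\<bar>real_of_int n\<bar> < 1" by (simp add: abs_mult)
  then have "n = 0" by linarith
  then show "u = v" using n by simp
qed

section \<open>Smoothness and regularity\<close>

text \<open>Holomorphic functions supply all derivatives at once, namely the real parts of the
  iterated complex derivatives.\<close>

lemma smooth_curve_Re_holomorphic:
  assumes f: "f holomorphic_on S" and S: "open S" and sub: "of_real ` {a..b} \<subseteq> S"
    and g: "\<And>t. g t = Re (f (of_real t))"
  shows "smooth_curve g a b"
  unfolding smooth_curve_def
proof (intro exI conjI allI ballI)
  let ?D = "\<lambda>n t. Re ((deriv ^^ n) f (of_real t))"
  show "?D 0 = g" using g by auto
  fix n t assume "t \<in> {a..b}"
  then have t: "of_real t \<in> S" using sub by auto
  have "(deriv ^^ n) f holomorphic_on S" using f S by (rule holomorphic_higher_deriv)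
  then have "((deriv ^^ n) f has_field_derivative (deriv ^^ Suc n) f (of_real t)) (at (of_real t))"
    using holomorphic_derivI[OF _ S t] by simp
  then have "((\<lambda>t. (deriv ^^ n) f (of_real t)) has_vector_derivative (deriv ^^ Suc n) f (of_real t))
      (at t within {a..b})"
    by (rule has_vector_derivative_real_field)
  then show "(?D n has_vector_derivative ?D (Suc n) t) (at t within {a..b})"
    by (rule bounded_linear.has_vector_derivative[OF bounded_linear_Re])
qed

lemma smooth_curve_Pair:
  assumes "smooth_curve f a b" and "smooth_curve g a b"
  shows "smooth_curve (\<lambda>t. (f t, g t)) a b"
proof -
  obtain D E where D: "D 0 = f"
      "\<And>n t. t \<in> {a..b} \<Longrightarrow> (D n has_vector_derivative D (Suc n) t) (at t within {a..b})"
    and E: "E 0 = g"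
      "\<And>n t. t \<in> {a..b} \<Longrightarrow> (E n has_vector_derivative E (Suc n) t) (at t within {a..b})"
    using assms unfolding smooth_curve_def by metis
  show ?thesis
    unfolding smooth_curve_def
    by (rule exI[of _ "\<lambda>n t. (D n t, E n t)"]) (auto simp: D E intro!: has_vector_derivative_Pair)
qed

lemma smooth_rho1: "smooth_curve (rho1 w M) a b"
proof (rule smooth_curve_Re_holomorphic)
  show "(\<lambda>z. of_real (heart_A w M) * cos z) holomorphic_on UNIV"
    by (intro holomorphic_intros)
  show "rho1 w M t = Re (of_real (heart_A w M) * cos (of_real t))" for t
    unfolding rho1_def by (simp add: cos_of_real)
qed auto

text \<open>The extension is holomorphic where both complexified radicands avoid the cut of the
  principal square root; this open set contains the real line because the radicands are positive
  there.\<close>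

lemma smooth_rho2:
  fixes M w :: real
  assumes M: "M > - 1 / 4" and w: "w > 0"
  shows "smooth_curve (rho2 w M) a b"
proof -
  define R :: "complex \<Rightarrow> complex" where
    "R z = of_real (1 + 4 * M) + of_real (heart_B w M) * (cos z)\<^sup>2" for z
  define Q :: "complex \<Rightarrow> complex" where
    "Q z = 1 + of_real (w\<^sup>2 * (heart_A w M)\<^sup>2) * (cos z)\<^sup>2" for z
  define S where "S = R -` (- \<real>\<^sub>\<le>\<^sub>0) \<inter> Q -` (- \<real>\<^sub>\<le>\<^sub>0)"
  have R: "R (of_real t) = of_real (1 + 4 * M + heart_B w M * (cos t)\<^sup>2)" for t
    unfolding R_def by (simp add: cos_of_real)
  have Q: "Q (of_real t) = of_real (1 + w\<^sup>2 * (heart_A w M)\<^sup>2 * (cos t)\<^sup>2)" for t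
    unfolding Q_def by (simp add: cos_of_real)
  show ?thesis
  proof (rule smooth_curve_Re_holomorphic)
    show "open S"
      unfolding S_def R_def Q_def
      by (intro open_Int open_vimage continuous_intros) auto
    show "(\<lambda>z. (- 1 + csqrt (R z) * sin z) / (2 * csqrt (Q z))) holomorphic_on S"
    proof (intro holomorphic_intros)
      show "R holomorphic_on S" "Q holomorphic_on S"
        unfolding R_def Q_def by (intro holomorphic_intros)+
    qed (auto simp: S_def)
    show "of_real ` {a..b} \<subseteq> S"
    proof
      fix z :: complex assume "z \<in> of_real ` {a..b}"
      then obtain t where z: "z = of_real t" by auto
      show "z \<in> S"
        using heart_radicands_pos[OF M w, of "cos t"]
        unfolding S_def z vimage_def Int_iff mem_Collect_eq Compl_iff R Q
          nonpos_Reals_of_real_iff by linarith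
    qed
    show "rho2 w M t = Re ((- 1 + csqrt (R (of_real t)) * sin (of_real t))
        / (2 * csqrt (Q (of_real t))))" for t
    proof -
      have "csqrt (R (of_real t)) = of_real (sqrt (1 + 4 * M + heart_B w M * (cos t)\<^sup>2))"
        "csqrt (Q (of_real t)) = of_real (sqrt (1 + w\<^sup>2 * (heart_A w M)\<^sup>2 * (cos t)\<^sup>2))"
        unfolding R Q using heart_radicands_pos[OF M w, of "cos t"]
        by (subst of_real_sqrt; simp)+
      then have "(- 1 + csqrt (R (of_real t)) * sin (of_real t)) / (2 * csqrt (Q (of_real t)))
          = complex_of_real (rho2 w M t)"
        unfolding rho2_def by (simp add: sin_of_real)
      then show ?thesis by simp
    qed
  qed
qed

text \<open>Where the sine vanishes, so does the derivative of any function of the squared cosine;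
  only the explicit factor \<open>sin u\<close> in \<open>rho2\<close> contributes.\<close>

lemma rho2_deriv_where_sin_zero:
  fixes M w t :: real
  assumes M: "M > - 1 / 4" and w: "w > 0" and s: "sin t = 0"
  shows "(rho2 w M has_real_derivative
    sqrt (1 + 4 * M + heart_B w M * (cos t)\<^sup>2) * cos t
      / (2 * sqrt (1 + w\<^sup>2 * (heart_A w M)\<^sup>2 * (cos t)\<^sup>2))) (at t)"
proof -
  define r where "r u = sqrt (1 + 4 * M + heart_B w M * (cos u)\<^sup>2)" for u
  define q where "q u = sqrt (1 + w\<^sup>2 * (heart_A w M)\<^sup>2 * (cos u)\<^sup>2)" for u
  note pos = heart_radicands_pos[OF M w, of "cos t"]
  have r: "(r has_real_derivative 0) (at t)"
    unfolding r_def using pos s by (auto intro!: derivative_eq_intros)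
  have q: "(q has_real_derivative 0) (at t)"
    unfolding q_def using pos s by (auto intro!: derivative_eq_intros)
  have q0: "q t > 0" unfolding q_def using pos by simp
  have "((\<lambda>u. (- 1 + r u * sin u) / (2 * q u)) has_real_derivative r t * cos t / (2 * q t)) (at t)"
    using q0 s by (auto intro!: derivative_eq_intros r q simp: field_simps)
  moreover have "(\<lambda>u. (- 1 + r u * sin u) / (2 * q u)) = rho2 w M"
    unfolding r_def q_def rho2_def by auto
  ultimately show ?thesis unfolding r_def q_def by simp
qed

lemma heart_curve_param_regular:
  fixes M w a b :: real
  assumes M: "M > - 1 / 4" and w: "w > 0" and ab: "a < b"
  shows "regular_curve (\<lambda>u. (rho1 w M u, rho2 w M u)) a b"
  unfolding regular_curve_def
proof (intro conjI ballI notI)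
  let ?g = "\<lambda>u. (rho1 w M u, rho2 w M u)"
  show smooth: "smooth_curve ?g a b"
    by (intro smooth_curve_Pair smooth_rho1 smooth_rho2[OF M w])
  fix t assume t: "t \<in> {a..b}"
    and zero: "vector_derivative ?g (at t within {a..b}) = 0"
  have "?g differentiable (at t within {a..b})"
    using smooth t unfolding smooth_curve_def by (metis differentiableI_vector)
  then have g0: "(?g has_vector_derivative (0, 0)) (at t within {a..b})"
    using zero by (simp add: vector_derivative_works zero_prod_def)
  have unique: "x = y" if "(h has_vector_derivative x) (at t within {a..b})"
    "(h has_real_derivative y) (at t)" for h :: "real \<Rightarrow> real" and x y
    using that vector_derivative_unique_within_closed_interval[OF ab] t
    by (metis cbox_interval has_real_derivative_iff_has_vector_derivative
        has_vector_derivative_at_within)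
  have "(rho1 w M has_vector_derivative 0) (at t within {a..b})"
    using bounded_linear.has_vector_derivative[OF bounded_linear_fst g0] by simp
  moreover have "(rho1 w M has_real_derivative - heart_A w M * sin t) (at t)"
    unfolding rho1_def by (auto intro!: derivative_eq_intros)
  ultimately have "0 = - heart_A w M * sin t" by (rule unique)
  then have s: "sin t = 0" using heart_A_pos_and_root(1)[OF M w] by simp
  have "(rho2 w M has_vector_derivative 0) (at t within {a..b})"
    using bounded_linear.has_vector_derivative[OF bounded_linear_snd g0] by simp
  from unique[OF this rho2_deriv_where_sin_zero[OF M w s]]
  have "cos t = 0" using heart_radicands_pos[OF M w, of "cos t"] by auto
  then show False using s sin_cos_squared_add[of t] by simp
qed

theorem lemma1p6:
  fixes M w :: real
  assumes "M > - 1 / 4" and "w > 0"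
  defines "\<gamma> \<equiv> \<lambda>u. (rho1 w M u, rho2 w M u)"
  shows "closed_simple_curve \<gamma> 0 (2 * pi) \<and>
         regular_curve \<gamma> 0 (2 * pi) \<and>
         \<gamma> ` {0..2 * pi} = heart_curve w M"
proof (intro conjI)
  show "closed_simple_curve \<gamma> 0 (2 * pi)"
    unfolding closed_simple_curve_def \<gamma>_def
    using heart_curve_param_inj[OF assms(1,2)] by (simp add: rho1_def rho2_def)
  show "regular_curve \<gamma> 0 (2 * pi)"
    unfolding \<gamma>_def by (rule heart_curve_param_regular[OF assms(1,2)]) simp
  show "\<gamma> ` {0..2 * pi} = heart_curve w M"
  proof (intro equalityI subsetI)
    show "p \<in> heart_curve w M" if "p \<in> \<gamma> ` {0..2 * pi}" for p
      using that heart_curve_param_mem[OF assms(1,2)] unfolding \<gamma>_def by auto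
    show "p \<in> \<gamma> ` {0..2 * pi}" if mem: "p \<in> heart_curve w M" for p
    proof -
      obtain x y where p: "p = (x, y)" by fastforce
      obtain u where "0 \<le> u" "u \<le> 2 * pi" "rho1 w M u = x" "rho2 w M u = y"
        by (rule heart_curve_param_surj[OF assms(1,2) mem[unfolded p]])
      then show ?thesis unfolding \<gamma>_def p by auto
    qed
  qed
qed

end
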